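(* Let $n\ge 2$ be an integer, let $\alpha\in(0,1)$, and let $(X_1,\ldots,X_n)$ be jointly normal with $X_i\sim N(\mu_i,1)$ and correlation matrix $\Sigma_n$ whose $(i,j)$-th entry is $\rho_{ij}$. For an integer $k$ with $1<k\le n$ let $A_i=\{X_i>\Phi^{-1}(1-k\alpha/n)\}$ for $1\le i\le n$. Then $$k\text{-FWER}(n,\alpha,\Sigma_n)\le\min\{A,B\},$$ where $$A:=\min_{2\le m\le k}\left[\frac{S_1-S'_m}{k}+\frac{k-m+1}{k}\cdot\max_{i_1<\cdots<i_{m-1}}\mathbb{P}(A_{i_1}\cap\cdots\cap A_{i_{m-1}})\right],\qquad B:=\min_{1\le m\le k}\frac{S_m}{\binom{k}{m}},$$ and all probabilities are computed under the global null hypothesis $H_0:\mu_1=\cdots=\mu_n=0$.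
   Context: $\Phi$ is the standard normal distribution function. The generalized familywise error rate of the Lehmann–Romano (Bonferroni-type) procedure under the global null is $$k\text{-FWER}(n,\alpha,\Sigma_n)=\mathbb{P}_{\Sigma_n}\left(X_i>\Phi^{-1}(1-k\alpha/n)\text{ for at least }k\text{ indices }i\mid H_0\right),$$ where "$\mid H_0$" means computed under $H_0$ (all $\mu_i=0$). For $1\le m\le n$, $$S_m=\sum_{1\le i_1<\cdots<i_m\le n}\mathbb{P}(A_{i_1}\cap\cdots\cap A_{i_m}),$$ and for $2\le m\le n$, $$S'_m=\max_{i_1<\cdots<i_{m-1}}\ \sum_{j=1,\ j\notin\{i_1,\ldots,i_{m-1}\}}^{n}\mathbb{P}(A_j\cap A_{i_1}\cap\cdots\cap A_{i_{m-1}}),$$ where maxima are over indices $1\le i_1<\cdots<i_{m-1}\le n$. *)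

theory Defs
  imports "HOL-Probability.Probability"
begin

definition std_normal_cdf :: "real \<Rightarrow> real" where
  "std_normal_cdf = cdf std_normal_distribution"

text \<open>
  The standard normal distribution function is a bijection from the reals onto the open unit
  interval, so the following is the true quantile for arguments in (0,1); outside of that
  interval the value is unspecified.
\<close>

definition std_normal_quantile :: "real \<Rightarrow> real" where
  "std_normal_quantile = inv std_normal_cdf"

text \<open>
  The normal law with standard deviation \<open>\<sigma>\<close>. The case \<open>\<sigma> = 0\<close> is the point mass at the mean; it is
  needed because the correlation matrix may be singular.
\<close>

definition normal_law :: "real \<Rightarrow> real \<Rightarrow> real measure" where
  "normal_law m \<sigma> = (if \<sigma> = 0 then return borel m else density lborel (normal_density m \<sigma>))"

text \<open>
  Random vectors are families \<open>X 1, \<dots>, X n\<close>. Joint normality: every linear combination of the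
  components is a (possibly degenerate) univariate normal variable.
\<close>

definition jointly_normal :: "'a measure \<Rightarrow> nat \<Rightarrow> (nat \<Rightarrow> 'a \<Rightarrow> real) \<Rightarrow> bool" where
  "jointly_normal M n X \<longleftrightarrow>
     (\<forall>i\<in>{1..n}. X i \<in> borel_measurable M) \<and>
     (\<forall>c :: nat \<Rightarrow> real. \<exists>m \<sigma>. \<sigma> \<ge> 0 \<and>
        distr M borel (\<lambda>\<omega>. \<Sum>i=1..n. c i * X i \<omega>) = normal_law m \<sigma>)"

definition covariance :: "'a measure \<Rightarrow> ('a \<Rightarrow> real) \<Rightarrow> ('a \<Rightarrow> real) \<Rightarrow> real" where
  "covariance M Y Z =
     (\<integral>\<omega>. (Y \<omega> - (\<integral>\<omega>'. Y \<omega>' \<partial>M)) * (Z \<omega> - (\<integral>\<omega>'. Z \<omega>' \<partial>M)) \<partial>M)"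

definition correlation :: "'a measure \<Rightarrow> ('a \<Rightarrow> real) \<Rightarrow> ('a \<Rightarrow> real) \<Rightarrow> real" where
  "correlation M Y Z = covariance M Y Z / (sqrt (covariance M Y Y) * sqrt (covariance M Z Z))"

definition correlation_matrix ::
    "'a measure \<Rightarrow> nat \<Rightarrow> (nat \<Rightarrow> 'a \<Rightarrow> real) \<Rightarrow> (nat \<Rightarrow> nat \<Rightarrow> real) \<Rightarrow> bool" where
  "correlation_matrix M n X \<rho> \<longleftrightarrow> (\<forall>i\<in>{1..n}. \<forall>j\<in>{1..n}. correlation M (X i) (X j) = \<rho> i j)"

definition rejection_event ::
    "'a measure \<Rightarrow> nat \<Rightarrow> nat \<Rightarrow> real \<Rightarrow> (nat \<Rightarrow> 'a \<Rightarrow> real) \<Rightarrow> nat \<Rightarrow> 'a set" where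
  "rejection_event M n k \<alpha> X i =
     {\<omega> \<in> space M. X i \<omega> > std_normal_quantile (1 - real k * \<alpha> / real n)}"

text \<open>
  The generalized familywise error rate under the global null. Here \<open>M\<close> is the null distribution:
  it is to be used only when all means of \<open>X\<close> under \<open>M\<close> vanish. The value is then a function of
  \<open>n\<close>, \<open>k\<close>, \<open>\<alpha>\<close> and the correlation matrix, since these determine the joint law of \<open>X\<close>.
\<close>

definition kFWER :: "'a measure \<Rightarrow> nat \<Rightarrow> nat \<Rightarrow> real \<Rightarrow> (nat \<Rightarrow> 'a \<Rightarrow> real) \<Rightarrow> real" where
  "kFWER M n k \<alpha> X =
     measure M {\<omega> \<in> space M.
       card {i \<in> {1..n}. X i \<omega> > std_normal_quantile (1 - real k * \<alpha> / real n)} \<ge> k}"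

text \<open>Strictly increasing tuples of \<open>m\<close> indices between 1 and \<open>n\<close> are represented by their range.\<close>

definition index_sets :: "nat \<Rightarrow> nat \<Rightarrow> nat set set" where
  "index_sets n m = {I. I \<subseteq> {1..n} \<and> card I = m}"

text \<open>
  The quantities below use \<open>\<Inter>i\<in>I. A i\<close> for nonempty \<open>I\<close> only: \<open>m \<ge> 1\<close> in \<open>S_sum\<close>, and \<open>m \<ge> 2\<close> in
  \<open>S'_max\<close> and \<open>max_joint\<close>, whose index sets have \<open>m - 1\<close> elements.
\<close>

definition S_sum :: "'a measure \<Rightarrow> nat \<Rightarrow> (nat \<Rightarrow> 'a set) \<Rightarrow> nat \<Rightarrow> real" where
  "S_sum M n A m = (\<Sum>I\<in>index_sets n m. measure M (\<Inter>i\<in>I. A i))"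

definition S'_max :: "'a measure \<Rightarrow> nat \<Rightarrow> (nat \<Rightarrow> 'a set) \<Rightarrow> nat \<Rightarrow> real" where
  "S'_max M n A m =
     Max ((\<lambda>I. \<Sum>j\<in>{1..n} - I. measure M (A j \<inter> (\<Inter>i\<in>I. A i))) ` index_sets n (m - 1))"

definition max_joint :: "'a measure \<Rightarrow> nat \<Rightarrow> (nat \<Rightarrow> 'a set) \<Rightarrow> nat \<Rightarrow> real" where
  "max_joint M n A m = Max ((\<lambda>I. measure M (\<Inter>i\<in>I. A i)) ` index_sets n (m - 1))"

end

theory Submission
  imports Defs
begin

text \<open>
  Let \<open>N\<close> be the number of the events \<open>A i\<close> that occur. Both bounds are expectations of pointwise
  inequalities. For the binomial bound, exactly \<open>N choose m\<close> of the \<open>m\<close>-fold intersections occur,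
  and \<open>(k choose m) 1{N \<ge> k} \<le> N choose m\<close>. For the other bound, fix an index set \<open>I\<close> with
  \<open>m - 1\<close> elements and let \<open>C\<close> be the intersection of the \<open>A i\<close> over \<open>I\<close>; then
  \<open>k 1{N \<ge> k} \<le> N - (N - (m - 1)) 1{C} + (k - m + 1) 1{C}\<close>, because the right-hand side is \<open>k\<close>
  on \<open>C\<close> and \<open>N\<close> off \<open>C\<close>. Choose \<open>I\<close> to attain the maximum in \<open>S'\<close>.
\<close>

text \<open>Lets a count be integrated as a sum of indicators. The family is arbitrary: it serves
  for the events \<open>A i\<close> and also for their \<open>m\<close>-fold intersections, indexed
  by sets.\<close>

lemma sum_indicator_family_eq_card:
  assumes "finite J"
  shows "(\<Sum>i\<in>J. indicator (A i) \<omega>) = real (card {i \<in> J. \<omega> \<in> A i})"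
proof -
  have "J \<inter> {i. \<omega> \<in> A i} = {i \<in> J. \<omega> \<in> A i}"
    by auto
  then show ?thesis
    using assms by (simp add: indicator_def)
qed

context finite_measure
begin

lemma measurable_card_ge:
  assumes "finite J" and A: "\<And>i. i \<in> J \<Longrightarrow> A i \<in> sets M"
  shows "{\<omega> \<in> space M. k \<le> card {i \<in> J. \<omega> \<in> A i}} \<in> sets M"
proof -
  have "{\<omega> \<in> space M. k \<le> card {i \<in> J. \<omega> \<in> A i}} =
      {\<omega> \<in> space M. real k \<le> (\<Sum>i\<in>J. indicator (A i) \<omega>)}"
    by (simp add: sum_indicator_family_eq_card[OF \<open>finite J\<close>])
  also have "\<dots> \<in> sets M"
    using A by measurable
  finally show ?thesis .
qed

lemma measure_card_ge_le_binomial: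
  assumes "finite J" and A: "\<And>i. i \<in> J \<Longrightarrow> A i \<in> sets M" and "0 < m"
  shows "real (k choose m) * measure M {\<omega> \<in> space M. k \<le> card {i \<in> J. \<omega> \<in> A i}}
    \<le> (\<Sum>I | I \<subseteq> J \<and> card I = m. measure M (\<Inter>i\<in>I. A i))"
proof -
  let ?E = "{\<omega> \<in> space M. k \<le> card {i \<in> J. \<omega> \<in> A i}}"
  let ?\<I> = "{I. I \<subseteq> J \<and> card I = m}"
  have [measurable]: "?E \<in> sets M"
    using measurable_card_ge[OF assms(1,2)] by simp
  \<comment> \<open>\<open>0 < m\<close> makes \<open>I\<close> nonempty; the empty intersection
    would be \<open>UNIV\<close>, which may exceed \<open>space M\<close>.\<close>
  have Int[measurable]: "(\<Inter>i\<in>I. A i) \<in> sets M" if "I \<in> ?\<I>" for I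
    using that \<open>finite J\<close> \<open>0 < m\<close> A
    by (intro sets.finite_INT) (auto intro: finite_subset)
  have "real (k choose m) * measure M ?E = (\<integral>\<omega>. real (k choose m) * indicator ?E \<omega> \<partial>M)"
    by simp
  also have "\<dots> \<le> (\<integral>\<omega>. (\<Sum>I\<in>?\<I>. indicator (\<Inter>i\<in>I. A i) \<omega>) \<partial>M)"
  proof (rule integral_mono)
    fix \<omega> assume "\<omega> \<in> space M"
    let ?K = "{i \<in> J. \<omega> \<in> A i}"
    have "finite ?\<I>"
      using \<open>finite J\<close> by simp
    then have "(\<Sum>I\<in>?\<I>. indicator (\<Inter>i\<in>I. A i) \<omega> :: real)
        = real (card {I \<in> ?\<I>. \<omega> \<in> (\<Inter>i\<in>I. A i)})"
      by (rule sum_indicator_family_eq_card)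
    \<comment> \<open>All events indexed by \<open>I\<close> occur exactly when \<open>I\<close>
      lies inside the set \<open>?K\<close> of occurring indices.\<close>
    also have "{I \<in> ?\<I>. \<omega> \<in> (\<Inter>i\<in>I. A i)} = {I. I \<subseteq> ?K \<and> card I = m}"
      by auto
    also have "card \<dots> = card ?K choose m"
      using \<open>finite J\<close> by (intro n_subsets) simp
    \<comment> \<open>On \<open>?E\<close> the binomial coefficient is monotone in its upper
      argument; off \<open>?E\<close> the left-hand side is 0.\<close>
    finally show "real (k choose m) * indicator ?E \<omega>
        \<le> (\<Sum>I\<in>?\<I>. indicator (\<Inter>i\<in>I. A i) \<omega>)"
      by (simp add: indicator_def binomial_right_mono)
  next
    show "integrable M (\<lambda>\<omega>. real (k choose m) * indicator ?E \<omega>)"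
      by (simp add: emeasure_finite less_top[symmetric])
    show "integrable M (\<lambda>\<omega>. \<Sum>I\<in>?\<I>. indicator (\<Inter>i\<in>I. A i) \<omega> :: real)"
      using Int by (intro Bochner_Integration.integrable_sum integrable_real_indicator)
        (auto simp: emeasure_finite less_top[symmetric])
  qed
  also have "\<dots> = (\<Sum>I\<in>?\<I>. \<integral>\<omega>. indicator (\<Inter>i\<in>I. A i) \<omega> \<partial>M)"
    using Int by (intro Bochner_Integration.integral_sum integrable_real_indicator)
      (auto simp: emeasure_finite less_top[symmetric])
  also have "\<dots> = (\<Sum>I\<in>?\<I>. measure M (\<Inter>i\<in>I. A i))"
    using Int by (intro sum.cong refl) (simp add: measure_def[symmetric])
  finally show ?thesis .
qed

text \<open>Generalises Kounias's bound for the probability of a union, which is the case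
  \<open>k = 1\<close> with a singleton \<open>I\<close>. Leaving \<open>I\<close> free allows it to
  be chosen later so as to maximise the subtracted sum.\<close>

lemma measure_card_ge_le_kounias:
  assumes "finite J" and A: "\<And>i. i \<in> J \<Longrightarrow> A i \<in> sets M"
    and "I \<subseteq> J" and "I \<noteq> {}"
  shows "real k * measure M {\<omega> \<in> space M. k \<le> card {i \<in> J. \<omega> \<in> A i}}
    \<le> (\<Sum>j\<in>J. measure M (A j)) - (\<Sum>j\<in>J - I. measure M (A j \<inter> (\<Inter>i\<in>I. A i)))
      + (real k - real (card I)) * measure M (\<Inter>i\<in>I. A i)"
proof -
  let ?E = "{\<omega> \<in> space M. k \<le> card {i \<in> J. \<omega> \<in> A i}}"
  let ?C = "\<Inter>i\<in>I. A i"
  let ?f = "\<lambda>\<omega>. (\<Sum>j\<in>J. indicator (A j) \<omega>) - (\<Sum>j\<in>J - I. indicator (A j \<inter> ?C) \<omega>)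
      + (real k - real (card I)) * indicator ?C \<omega>"
  have "finite I"
    using assms by (auto intro: finite_subset)
  have [measurable]: "?E \<in> sets M"
    using measurable_card_ge[OF assms(1,2)] by simp
  have C[measurable]: "?C \<in> sets M"
    using \<open>finite I\<close> assms by (intro sets.finite_INT) auto
  have int: "integrable M (indicator B :: _ \<Rightarrow> real)" if "B \<in> sets M" for B
    using that by (simp add: emeasure_finite less_top[symmetric])
  have AC: "A j \<inter> ?C \<in> sets M" if "j \<in> J - I" for j
    using that A C by auto
  have int_J: "integrable M (\<lambda>\<omega>. \<Sum>j\<in>J. indicator (A j) \<omega> :: real)"
    using A by (intro Bochner_Integration.integrable_sum int)
  have int_JI: "integrable M (\<lambda>\<omega>. \<Sum>j\<in>J - I. indicator (A j \<inter> ?C) \<omega> :: real)"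
    using AC by (intro Bochner_Integration.integrable_sum int)
  have "real k * measure M ?E = (\<integral>\<omega>. real k * indicator ?E \<omega> \<partial>M)"
    by simp
  also have "\<dots> \<le> (\<integral>\<omega>. ?f \<omega> \<partial>M)"
  proof (rule integral_mono)
    fix \<omega> assume "\<omega> \<in> space M"
    let ?K = "{i \<in> J. \<omega> \<in> A i}"
    have N: "(\<Sum>j\<in>J. indicator (A j) \<omega> :: real) = real (card ?K)"
      by (rule sum_indicator_family_eq_card) fact
    show "real k * indicator ?E \<omega> \<le> ?f \<omega>"
    proof (cases "\<omega> \<in> ?C")
      case True
      then have "I \<subseteq> ?K"
        using \<open>I \<subseteq> J\<close> by auto
      have "(\<Sum>j\<in>J - I. indicator (A j \<inter> ?C) \<omega> :: real) = real (card {j \<in> J - I. \<omega> \<in> A j \<inter> ?C})"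
        using \<open>finite J\<close> by (intro sum_indicator_family_eq_card) simp
      \<comment> \<open>On \<open>?C\<close> every index of \<open>I\<close> is among the occurring
        ones, so the subtracted sum counts the remaining occurrences and \<open>?f\<close> collapses
        to \<open>k\<close>.\<close>
      also have "{j \<in> J - I. \<omega> \<in> A j \<inter> ?C} = ?K - I"
        using True by auto
      also have "real (card (?K - I)) = real (card ?K) - real (card I)"
        using \<open>I \<subseteq> ?K\<close> \<open>finite I\<close> \<open>finite J\<close>
        by (simp add: card_Diff_subset card_mono of_nat_diff)
      finally show ?thesis
        using True N by (simp add: indicator_def)
    next
      case False
      then have "indicator ?C \<omega> = (0 :: real)"
        by (rule indicator_simps)
      \<comment> \<open>Off \<open>?C\<close> both terms that involve \<open>?C\<close> vanish. The
        remaining count is at least \<open>k\<close> on \<open>?E\<close> and nonnegative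
        elsewhere.\<close>
      then have "?f \<omega> = real (card ?K)"
        by (simp only: N indicator_inter_arith) simp
      then show ?thesis
        by (simp add: indicator_def)
    qed
  next
    show "integrable M (\<lambda>\<omega>. real k * indicator ?E \<omega>)"
      by (simp add: int)
    show "integrable M ?f"
      using int_J int_JI C by (simp add: int)
  qed
  also have "\<dots> = (\<Sum>j\<in>J. measure M (A j)) - (\<Sum>j\<in>J - I. measure M (A j \<inter> ?C))
      + (real k - real (card I)) * measure M ?C"
  proof -
    have "(\<integral>\<omega>. (\<Sum>j\<in>J. indicator (A j) \<omega>) \<partial>M) = (\<Sum>j\<in>J. measure M (A j))"
      using A by (simp add: int Bochner_Integration.integral_sum)
    moreover have "(\<integral>\<omega>. (\<Sum>j\<in>J - I. indicator (A j \<inter> ?C) \<omega>) \<partial>M)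
        = (\<Sum>j\<in>J - I. measure M (A j \<inter> ?C))"
      using AC by (subst Bochner_Integration.integral_sum)
        (simp_all add: int)
    ultimately show ?thesis
      using int_J int_JI C by (simp add: int)
  qed
  finally show ?thesis .
qed

end

lemma finite_index_sets: "finite (index_sets n m)"
  by (simp add: index_sets_def)

lemma index_sets_nonempty: "m \<le> n \<Longrightarrow> index_sets n m \<noteq> {}"
  unfolding index_sets_def
  by (auto intro!: exI[of _ "{1..m}"])

lemma S_sum_1: "S_sum M n A 1 = (\<Sum>j=1..n. measure M (A j))"
proof -
  have "index_sets n 1 = (\<lambda>j. {j}) ` {1..n}"
    by (auto simp: index_sets_def card_1_singleton_iff)
  then show ?thesis
    by (simp add: S_sum_def sum.reindex)
qed

theorem corollary5p1:
  fixes M :: "'a measure"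
    and X :: "nat \<Rightarrow> 'a \<Rightarrow> real"
    and \<mu> :: "nat \<Rightarrow> real"
    and \<rho> :: "nat \<Rightarrow> nat \<Rightarrow> real"
    and n k :: nat
    and \<alpha> :: real
    and A :: "nat \<Rightarrow> 'a set"
  assumes "prob_space M"
    and "n \<ge> 2"
    and "0 < \<alpha>" and "\<alpha> < 1"
    and "1 < k" and "k \<le> n"
    and "jointly_normal M n X"
    and "\<forall>i\<in>{1..n}. distributed M lborel (X i) (normal_density (\<mu> i) 1)"
    and "correlation_matrix M n X \<rho>"
    and H0: "\<forall>i\<in>{1..n}. \<mu> i = 0"
    and A_def: "\<forall>i\<in>{1..n}. A i = rejection_event M n k \<alpha> X i"
  shows "kFWER M n k \<alpha> X \<le>
    min
      (MIN m\<in>{2..k}.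
         (S_sum M n A 1 - S'_max M n A m) / real k
           + (real k - real m + 1) / real k * max_joint M n A m)
      (MIN m\<in>{1..k}. S_sum M n A m / real (k choose m))"
proof -
  interpret prob_space M by fact
  have A: "A i \<in> sets M" if "i \<in> {1..n}" for i
  proof -
    have [measurable]: "X i \<in> borel_measurable M"
      using that \<open>jointly_normal M n X\<close> by (auto simp: jointly_normal_def)
    show ?thesis
      using that A_def by (simp add: rejection_event_def)
  qed
  let ?E = "{\<omega> \<in> space M. k \<le> card {i \<in> {1..n}. \<omega> \<in> A i}}"
  \<comment> \<open>Within \<open>space M\<close>, exceeding the threshold is membership in
    \<open>A i\<close>; \<open>conj_cong\<close> makes that restriction available when the counts
    are compared.\<close>
  have "kFWER M n k \<alpha> X = measure M ?E"
    unfolding kFWER_def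
    using A_def
    by (intro arg_cong[where f = "measure M"] Collect_cong conj_cong refl arg_cong[where f = "(\<le>) k"]
        arg_cong[where f = card]) (auto simp: rejection_event_def)
  moreover have "measure M ?E \<le> (S_sum M n A 1 - S'_max M n A m) / real k
      + (real k - real m + 1) / real k * max_joint M n A m" if m: "m \<in> {2..k}" for m
  proof -
    let ?F = "\<lambda>I. \<Sum>j\<in>{1..n} - I. measure M (A j \<inter> (\<Inter>i\<in>I. A i))"
    \<comment> \<open>Over a finite nonempty family \<open>Max\<close> is attained, which supplies
      the index set \<open>I\<close>.\<close>
    have "index_sets n (m - 1) \<noteq> {}"
      using m \<open>k \<le> n\<close> by (intro index_sets_nonempty) auto
    then have "S'_max M n A m \<in> ?F ` index_sets n (m - 1)"
      unfolding S'_max_def by (intro Max_in) (auto simp: finite_index_sets)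
    then obtain I where I: "I \<in> index_sets n (m - 1)" and S': "S'_max M n A m = ?F I"
      by auto
    have card: "card I = m - 1" and "I \<subseteq> {1..n}"
      using I by (auto simp: index_sets_def)
    have "I \<noteq> {}"
      using card m by auto
    \<comment> \<open>The \<open>I\<close> that maximises the sum need not maximise this
      probability, so the last term is only bounded by its own maximum.\<close>
    have max: "measure M (\<Inter>i\<in>I. A i) \<le> max_joint M n A m"
      unfolding max_joint_def using I by (intro Max_ge) (auto simp: finite_index_sets)
    have "real k * measure M ?E \<le> S_sum M n A 1 - S'_max M n A m
        + (real k - real (card I)) * measure M (\<Inter>i\<in>I. A i)"
      unfolding S_sum_1 S'
      using A \<open>I \<subseteq> {1..n}\<close> \<open>I \<noteq> {}\<close> by (intro measure_card_ge_le_kounias) auto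
    also have "real k - real (card I) = real k - real m + 1"
      using card m by simp
    \<comment> \<open>The coefficient is positive because \<open>m \<le> k\<close>.\<close>
    also have "(real k - real m + 1) * measure M (\<Inter>i\<in>I. A i)
        \<le> (real k - real m + 1) * max_joint M n A m"
      using max m by (intro mult_left_mono) auto
    finally have "measure M ?E \<le> (S_sum M n A 1 - S'_max M n A m
        + (real k - real m + 1) * max_joint M n A m) / real k"
      using \<open>1 < k\<close> by (simp add: pos_le_divide_eq mult.commute)
    then show ?thesis
      by (simp only: add_divide_distrib[where a = "S_sum M n A 1 - S'_max M n A m"]
          times_divide_eq_left)
  qed
  moreover have "measure M ?E \<le> S_sum M n A m / real (k choose m)" if m: "m \<in> {1..k}" for m
  proof -
    have "real (k choose m) * measure M ?E \<le> S_sum M n A m"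
      unfolding S_sum_def index_sets_def
      using A m by (intro measure_card_ge_le_binomial) auto
    \<comment> \<open>Division is allowed since \<open>m \<le> k\<close> makes
      \<open>k choose m\<close> positive.\<close>
    then show ?thesis
      using m by (simp add: field_simps)
  qed
  \<comment> \<open>By \<open>1 < k\<close> both ranges of \<open>m\<close> are nonempty, so a bound
    for each \<open>m\<close> bounds the minima.\<close>
  ultimately show ?thesis
    using \<open>1 < k\<close> by (auto intro!: min.boundedI Min.boundedI)
qed

end
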